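(* Let $I$ be a monomial ideal with set of minimal monomial generators $\mathcal G(I)$ and let $>_I$ be a total ordering on $\mathcal G(I)$. Then the collection of directed edges $A$ produced by the Barile-Macchia algorithm (described in the context) is an $\operatorname{lcm}$-homogeneous acyclic matching.
   Context: Let $R=\Bbbk[x_1,\dots,x_N]$ be a polynomial ring over a field, $I\subseteq R$ a monomial ideal, $\mathcal G(I)$ its set of minimal monomial generators, and $>_I$ a total ordering on $\mathcal G(I)$. For $\sigma\subseteq\mathcal G(I)$, $\operatorname{lcm}(\sigma)$ is the least common multiple of the elements of $\sigma$. Let $G=(V,E)$ be the directed graph whose vertices are all subsets of $\mathcal G(I)$ and whose directed edges are the pairs $(\sigma,\sigma')$ (from $\sigma$ to $\sigma'$) with $\sigma'\subseteq\sigma$ and $|\sigma'|=|\sigma|-1$. For $A\subseteq E$ let $G^A$ be obtained from $G$ by reversing the edges in $A$. The set $A\subseteq E$ is an $\operatorname{lcm}$-homogeneous acyclic matching if (1) every subset of $\mathcal G(I)$ appears in at most one edge of $A$; (2) $G^A$ has no directed cycle; (3) $\operatorname{lcm}(\sigma)=\operatorname{lcm}(\sigma')$ for all $(\sigma,\sigma')\in A$. A monomial $m\in\mathcal G(I)$ is a bridge of $\sigma\subseteq\mathcal G(I)$ if $m\in\sigma$ and $\operatorname{lcm}(\sigma\setminus\{m\})=\operatorname{lcm}(\sigma)$. Let $\operatorname{sb}(\sigma)$ be the smallest bridge of $\sigma$ with respect to $>_I$ if $\sigma$ has a bridge, and $\operatorname{sb}(\sigma)=\emptyset$ otherwise. We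 write $\sigma\setminus m$ for $\sigma\setminus\{m\}$, and $\sigma\setminus\emptyset=\sigma$. Barile-Macchia algorithm. Start with $A=\emptyset$ and $\Omega=\{\text{all subsets of }\mathcal G(I)\text{ of cardinality at least }3\}$. (1) Pick a subset $\sigma$ of maximal cardinality in $\Omega$. (2) Replace $\Omega$ by $\Omega\setminus\{\sigma,\sigma\setminus\operatorname{sb}(\sigma)\}$. If $\operatorname{sb}(\sigma)\ne\emptyset$, add the directed edge $(\sigma,\sigma\setminus\operatorname{sb}(\sigma))$ to $A$. If $\Omega\neq\emptyset$, return to step (1). (3) Whenever there exist distinct directed edges $(\sigma,\sigma\setminus\operatorname{sb}(\sigma))$ and $(\sigma',\sigma'\setminus\operatorname{sb}(\sigma'))$ in $A$ with $\sigma\setminus\operatorname{sb}(\sigma)=\sigma'\setminus\operatorname{sb}(\sigma')$: if $\operatorname{sb}(\sigma')>_I\operatorname{sb}(\sigma)$ remove $(\sigma',\sigma'\setminus\operatorname{sb}(\sigma'))$ from $A$; otherwise remove $(\sigma,\sigma\setminus\operatorname{sb}(\sigma))$ from $A$. The output is the final set $A$. *)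

theory Defs
  imports Complex_Main "HOL-Library.Poly_Mapping" "HOL-Library.Ramsey"
begin

text \<open>A monomial is represented by its exponent vector; the polynomial ring over \<open>'k\<close> in variables
  indexed by the finite type \<open>'n\<close> is the monoid ring of these exponent vectors.\<close>

type_synonym 'n monomial = "'n \<Rightarrow>\<^sub>0 nat"
type_synonym ('n, 'k) polynomial_ring = "('n \<Rightarrow>\<^sub>0 nat) \<Rightarrow>\<^sub>0 'k"

definition mon :: "'n monomial \<Rightarrow> ('n, 'k::field) polynomial_ring" where
  "mon m = Poly_Mapping.single m 1"

text \<open>Ideals are the submodules of the ring over itself, so \<^const>\<open>module.span\<close> for the ring
  multiplication is the ideal generated by a set.\<close>

definition monomial_ideal :: "('n, 'k::field) polynomial_ring set \<Rightarrow> bool" where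
  "monomial_ideal I \<longleftrightarrow> (\<exists>S. I = module.span (*) (mon ` S))"

text \<open>The monomials of \<open>I\<close> that are minimal under divisibility; see \<open>span_min_gens\<close> and
  \<open>min_gens_subset\<close> below: they form the smallest set of monomials generating \<open>I\<close>.\<close>

definition min_gens :: "('n, 'k::field) polynomial_ring set \<Rightarrow> 'n monomial set" where
  "min_gens I = {m. mon m \<in> I \<and>
     (\<forall>m'. mon m' \<in> I \<longrightarrow> (mon m' :: ('n, 'k) polynomial_ring) dvd mon m \<longrightarrow> m' = m)}"

text \<open>Inserting \<open>0\<close> makes the lcm of the empty set equal to the monomial \<open>1\<close>.\<close>

definition lcm_mon :: "'n::finite monomial set \<Rightarrow> 'n monomial" where
  "lcm_mon \<sigma> = Abs_poly_mapping (\<lambda>i. Max (insert 0 ((\<lambda>m. Poly_Mapping.lookup m i) ` \<sigma>)))"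


definition edges :: "'a set \<Rightarrow> ('a set \<times> 'a set) set" where
  "edges G = {(\<sigma>, \<sigma>'). \<sigma> \<subseteq> G \<and> \<sigma>' \<subseteq> \<sigma> \<and> card \<sigma>' + 1 = card \<sigma>}"

definition reverse_edges :: "('v \<times> 'v) set \<Rightarrow> ('v \<times> 'v) set \<Rightarrow> ('v \<times> 'v) set" where
  "reverse_edges E A = (E - A) \<union> A\<inverse>"

definition lcm_homogeneous_acyclic_matching ::
    "'n::finite monomial set \<Rightarrow> ('n monomial set \<times> 'n monomial set) set \<Rightarrow> bool" where
  "lcm_homogeneous_acyclic_matching G A \<longleftrightarrow>
     A \<subseteq> edges G \<and>
     (\<forall>\<sigma>. \<sigma> \<subseteq> G \<longrightarrow> (\<forall>e\<in>A. \<forall>e'\<in>A.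
        (\<sigma> = fst e \<or> \<sigma> = snd e) \<longrightarrow> (\<sigma> = fst e' \<or> \<sigma> = snd e') \<longrightarrow> e = e')) \<and>
     acyclic (reverse_edges (edges G) A) \<and>
     (\<forall>(\<sigma>, \<sigma>')\<in>A. lcm_mon \<sigma> = lcm_mon \<sigma>')"


definition bridge :: "'n::finite monomial \<Rightarrow> 'n monomial set \<Rightarrow> bool" where
  "bridge m \<sigma> \<longleftrightarrow> m \<in> \<sigma> \<and> lcm_mon (\<sigma> - {m}) = lcm_mon \<sigma>"

text \<open>A total ordering of the generators is given by its reflexive relation \<open>r\<close>:
  \<open>(a, b) \<in> r\<close> means that \<open>b\<close> is greater than or equal to \<open>a\<close>.
  \<^const>\<open>None\<close> encodes \<open>sb(\<sigma>) = \<emptyset>\<close>.\<close>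

definition sb :: "'n::finite monomial rel \<Rightarrow> 'n monomial set \<Rightarrow> 'n monomial option" where
  "sb r \<sigma> = (if \<exists>m. bridge m \<sigma>
     then Some (THE m. bridge m \<sigma> \<and> (\<forall>m'. bridge m' \<sigma> \<longrightarrow> (m, m') \<in> r)) else None)"

definition remove_sb :: "'n::finite monomial rel \<Rightarrow> 'n monomial set \<Rightarrow> 'n monomial set" where
  "remove_sb r \<sigma> = (case sb r \<sigma> of None \<Rightarrow> \<sigma> | Some m \<Rightarrow> \<sigma> - {m})"

text \<open>One pass through the selection loop, on states \<open>(\<Omega>, A)\<close>. The loop ends when \<open>\<Omega>\<close> is empty.\<close>

inductive bm_select :: "'n::finite monomial rel \<Rightarrow>
    'n monomial set set \<times> ('n monomial set \<times> 'n monomial set) set \<Rightarrow>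
    'n monomial set set \<times> ('n monomial set \<times> 'n monomial set) set \<Rightarrow> bool"
  for r where
  "\<sigma> \<in> \<Omega> \<Longrightarrow> \<forall>\<tau>\<in>\<Omega>. card \<tau> \<le> card \<sigma> \<Longrightarrow>
     bm_select r (\<Omega>, A)
       (\<Omega> - {\<sigma>, remove_sb r \<sigma>},
        if sb r \<sigma> \<noteq> None then insert (\<sigma>, remove_sb r \<sigma>) A else A)"

text \<open>Removal of one of two distinct edges with the same target: the one whose removed bridge is larger.\<close>

inductive bm_prune :: "'n::finite monomial rel \<Rightarrow>
    ('n monomial set \<times> 'n monomial set) set \<Rightarrow>
    ('n monomial set \<times> 'n monomial set) set \<Rightarrow> bool"
  for r where
  "(\<sigma>, remove_sb r \<sigma>) \<in> A \<Longrightarrow> (\<sigma>', remove_sb r \<sigma>') \<in> A \<Longrightarrow>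
   (\<sigma>, remove_sb r \<sigma>) \<noteq> (\<sigma>', remove_sb r \<sigma>') \<Longrightarrow> remove_sb r \<sigma> = remove_sb r \<sigma>' \<Longrightarrow>
   sb r \<sigma> = Some m \<Longrightarrow> sb r \<sigma>' = Some m' \<Longrightarrow>
     bm_prune r A (A - {if (m, m') \<in> r \<and> m \<noteq> m' then (\<sigma>', remove_sb r \<sigma>') else (\<sigma>, remove_sb r \<sigma>)})"

text \<open>The choices of the set selected and of the pair of edges compared are left open: \<open>barile_macchia G r A\<close> says that some run
  of the algorithm on the generators \<open>G\<close> terminates with output \<open>A\<close>.\<close>

definition barile_macchia :: "'n::finite monomial set \<Rightarrow> 'n monomial rel \<Rightarrow>
    ('n monomial set \<times> 'n monomial set) set \<Rightarrow> bool" where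
  "barile_macchia G r A \<longleftrightarrow>
     (\<exists>A0. (bm_select r)\<^sup>*\<^sup>* ({\<sigma>. \<sigma> \<subseteq> G \<and> 3 \<le> card \<sigma>}, {}) ({}, A0) \<and>
           (bm_prune r)\<^sup>*\<^sup>* A0 A \<and> (\<nexists>A'. bm_prune r A A'))"


text \<open>The definitions of generators and lcm agree with their usual characterizations.\<close>

lemma mon_mult: "mon a * mon b = mon (a + b)"
  by (simp add: mon_def mult_single)

lemma mon_dvd_imp_keys:
  assumes "(mon m :: ('n, 'k::field) polynomial_ring) dvd f" "k \<in> Poly_Mapping.keys f"
  shows "\<exists>q. k = m + q"
proof -
  obtain g where "f = mon m * g" using assms(1) by (auto elim: dvdE)
  then have "k \<in> {a + b | a b. a \<in> Poly_Mapping.keys (mon m :: ('n, 'k) polynomial_ring) \<and> b \<in> Poly_Mapping.keys g}"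
    using assms(2) keys_mult by blast
  then show ?thesis by (auto simp: mon_def)
qed

lemma mon_dvd_iff: "(mon a :: ('n, 'k::field) polynomial_ring) dvd mon b \<longleftrightarrow> (\<exists>q. b = a + q)"
proof
  assume "(mon a :: ('n, 'k) polynomial_ring) dvd mon b"
  from mon_dvd_imp_keys[OF this, of b] show "\<exists>q. b = a + q" by (simp add: mon_def)
qed (metis mon_mult dvd_triv_left)

lemma module_times: "module ((*) :: 'a::comm_ring_1 \<Rightarrow> 'a \<Rightarrow> 'a)"
  by unfold_locales (auto simp: algebra_simps)

lemma keys_span_mon:
  assumes "f \<in> module.span (*) (mon ` S :: ('n, 'k::field) polynomial_ring set)"
    "k \<in> Poly_Mapping.keys f"
  shows "\<exists>s\<in>S. \<exists>q. k = s + q"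
proof -
  interpret module "(*) :: ('n, 'k) polynomial_ring \<Rightarrow> _" by (rule module_times)
  show ?thesis using assms
  proof (induction arbitrary: k rule: span_induct_alt)
    case base
    then show ?case by simp
  next
    case (step c x y)
    from step.hyps obtain s where s: "s \<in> S" "x = mon s" by (elim imageE)
    consider "k \<in> Poly_Mapping.keys (c * x)" | "k \<in> Poly_Mapping.keys y"
      using subsetD[OF Poly_Mapping.keys_add step.prems] by (elim UnE)
    then show ?case
    proof cases
      case 1
      have "mon s dvd c * x" using s by simp
      from mon_dvd_imp_keys[OF this 1] s show ?thesis by (intro bexI[of _ s])
    next
      case 2
      then show ?thesis by (rule step.IH)
    qed
  qed
qed

lemma mon_in_monomial_idealD:
  assumes "mon m \<in> module.span (*) (mon ` S :: ('n, 'k::field) polynomial_ring set)"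
  shows "\<exists>s\<in>S. \<exists>q. m = s + q"
  by (rule keys_span_mon[OF assms]) (simp add: mon_def)

lemma min_gens_subset:
  fixes I :: "('n, 'k::field) polynomial_ring set"
  assumes "module.span (*) (mon ` S) = I"
  shows "min_gens I \<subseteq> S"
proof
  fix m assume m: "m \<in> min_gens I"
  interpret module "(*) :: ('n, 'k) polynomial_ring \<Rightarrow> _" by (rule module_times)
  have "mon m \<in> span (mon ` S :: ('n, 'k) polynomial_ring set)"
    using m assms by (simp add: min_gens_def)
  then obtain s q where s: "s \<in> S" "m = s + q" using mon_in_monomial_idealD by blast
  moreover have "mon s \<in> I" using s(1) assms span_base by blast
  ultimately have "s = m" using m by (auto simp: min_gens_def mon_dvd_iff)
  with s(1) show "m \<in> S" by metis
qed

lemma span_min_gens: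
  fixes I :: "('n::finite, 'k::field) polynomial_ring set"
  assumes "monomial_ideal I"
  shows "module.span (*) (mon ` min_gens I) = I"
proof -
  interpret module "(*) :: ('n, 'k) polynomial_ring \<Rightarrow> _" by (rule module_times)
  obtain S where S: "I = span (mon ` S)" using assms by (auto simp: monomial_ideal_def)
  let ?d = "\<lambda>m::'n monomial. \<Sum>i\<in>UNIV. Poly_Mapping.lookup m i"
  have *: "mon m \<in> span (mon ` min_gens I)" if "mon m \<in> I" for m
    using that
  proof (induction "?d m" arbitrary: m rule: less_induct)
    case less
    show ?case
    proof (cases "m \<in> min_gens I")
      case True
      then show ?thesis by (simp add: span_base)
    next
      case False
      then obtain m' q where m': "mon m' \<in> I" "m = m' + q" "m' \<noteq> m"
        using less.prems by (auto simp: min_gens_def mon_dvd_iff)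
      then have "q \<noteq> 0" by auto
      then obtain i where "Poly_Mapping.lookup q i \<noteq> 0"
        by (metis lookup_zero poly_mapping_eqI)
      then have "0 < ?d q" by (metis UNIV_I finite gr0I sum_eq_0_iff)
      then have "?d m' < ?d m" using m' by (simp add: lookup_add sum.distrib)
      then have "mon m' \<in> span (mon ` min_gens I)" using less.hyps m' by blast
      then have "mon q * mon m' \<in> span (mon ` min_gens I)" by (rule span_scale)
      then show ?thesis using m' by (simp add: mon_mult add.commute)
    qed
  qed
  show ?thesis
  proof
    have "mon ` min_gens I \<subseteq> I" by (auto simp: min_gens_def)
    moreover have "subspace I" unfolding S by (rule subspace_span)
    ultimately show "span (mon ` min_gens I) \<subseteq> I" by (rule span_minimal)
    have "mon ` S \<subseteq> I" unfolding S by (rule span_superset)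
    then have "mon ` S \<subseteq> span (mon ` min_gens I)" using * by blast
    then have "span (mon ` S) \<subseteq> span (mon ` min_gens I)" by (rule span_minimal) (rule subspace_span)
    then show "I \<subseteq> span (mon ` min_gens I)" using S by simp
  qed
qed

lemma lookup_lcm_mon:
  "Poly_Mapping.lookup (lcm_mon \<sigma>) i = Max (insert 0 ((\<lambda>m. Poly_Mapping.lookup m i) ` \<sigma>))"
  by (simp add: lcm_mon_def)

lemma add_iff_lookup_le:
  fixes a b :: "'n::finite monomial"
  shows "(\<exists>q. b = a + q) \<longleftrightarrow> (\<forall>i. Poly_Mapping.lookup a i \<le> Poly_Mapping.lookup b i)"
proof
  assume "\<forall>i. Poly_Mapping.lookup a i \<le> Poly_Mapping.lookup b i"
  then have "b = a + (b - a)" by (intro poly_mapping_eqI) (simp add: lookup_add lookup_minus)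
  then show "\<exists>q. b = a + q" by blast
qed (auto simp: lookup_add)

lemma lcm_mon_dvd_iff:
  fixes \<sigma> :: "'n::finite monomial set" and f :: "('n, 'k::field) polynomial_ring"
  assumes "finite \<sigma>"
  shows "mon (lcm_mon \<sigma>) dvd f \<longleftrightarrow> (\<forall>m\<in>\<sigma>. mon m dvd f)"
proof
  assume L: "mon (lcm_mon \<sigma>) dvd f"
  show "\<forall>m\<in>\<sigma>. mon m dvd f"
  proof
    fix m assume "m \<in> \<sigma>"
    then have "\<forall>i. Poly_Mapping.lookup m i \<le> Poly_Mapping.lookup (lcm_mon \<sigma>) i"
      using assms by (auto simp: lookup_lcm_mon intro!: Max_ge)
    then have "(mon m :: ('n, 'k) polynomial_ring) dvd mon (lcm_mon \<sigma>)"
      by (simp add: mon_dvd_iff add_iff_lookup_le)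
    then show "mon m dvd f" using L dvd_trans by blast
  qed
next
  assume R: "\<forall>m\<in>\<sigma>. mon m dvd f"
  have "mon (lcm_mon \<sigma>) dvd Poly_Mapping.single k (Poly_Mapping.lookup f k)"
    if k: "k \<in> Poly_Mapping.keys f" for k
  proof -
    have "Poly_Mapping.lookup m i \<le> Poly_Mapping.lookup k i" if "m \<in> \<sigma>" for m i
      using mon_dvd_imp_keys[OF R[rule_format, OF that] k] add_iff_lookup_le by blast
    then have "\<forall>i. Poly_Mapping.lookup (lcm_mon \<sigma>) i \<le> Poly_Mapping.lookup k i"
      using assms by (simp add: lookup_lcm_mon)
    then obtain q where "k = lcm_mon \<sigma> + q" using add_iff_lookup_le by blast
    then have "Poly_Mapping.single k (Poly_Mapping.lookup f k)
        = mon (lcm_mon \<sigma>) * Poly_Mapping.single q (Poly_Mapping.lookup f k)"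
      by (simp add: mon_def mult_single)
    then show ?thesis by simp
  qed
  then have "mon (lcm_mon \<sigma>) dvd
      (\<Sum>k\<in>Poly_Mapping.keys f. Poly_Mapping.single k (Poly_Mapping.lookup f k))"
    by (rule dvd_sum)
  moreover have "(\<Sum>k\<in>Poly_Mapping.keys f. Poly_Mapping.single k (Poly_Mapping.lookup f k)) = f"
    by (intro poly_mapping_eqI)
      (simp add: lookup_sum lookup_single when_def in_keys_iff)
  ultimately show "mon (lcm_mon \<sigma>) dvd f" by simp
qed


text \<open>The generating set is finite (Dickson's lemma), and the algorithm has an output.\<close>

lemma finite_min_gens:
  fixes I :: "('n::finite, 'k::field) polynomial_ring set"
  shows "finite (min_gens I)"
proof (rule ccontr)
  assume "infinite (min_gens I)"
  then obtain g :: "nat \<Rightarrow> 'n monomial" where g: "inj g" "range g \<subseteq> min_gens I"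
    using infinite_countable_subset by blast
  obtain h :: "'n \<Rightarrow> nat" where h: "bij_betw h UNIV {0..<card (UNIV :: 'n set)}"
    using ex_bij_betw_finite_nat[of "UNIV :: 'n set"] by auto
  define c where "c i j = (SOME v. Poly_Mapping.lookup (g j) v < Poly_Mapping.lookup (g i) v)"
    for i j
  have c: "Poly_Mapping.lookup (g j) (c i j) < Poly_Mapping.lookup (g i) (c i j)" if "i < j" for i j
  proof -
    have "\<exists>v. Poly_Mapping.lookup (g j) v < Poly_Mapping.lookup (g i) v"
    proof (rule ccontr)
      assume "\<not> ?thesis"
      then have "(mon (g i) :: ('n, 'k) polynomial_ring) dvd mon (g j)"
        by (simp add: mon_dvd_iff add_iff_lookup_le not_less)
      then have "g i = g j" using g(2) unfolding min_gens_def by blast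
      then show False using g(1) that by (simp add: inj_eq)
    qed
    then show ?thesis unfolding c_def by (rule someI_ex)
  qed
  have hlt: "h v < card (UNIV :: 'n set)" for v
    using h by (auto simp: bij_betw_def)
  obtain Y t where Y: "infinite Y" and
      t: "\<forall>x\<in>Y. \<forall>y\<in>Y. x \<noteq> y \<longrightarrow> h (c (Min {x, y}) (Max {x, y})) = t"
    using Ramsey2[of "UNIV :: nat set" "\<lambda>s. h (c (Min s) (Max s))" "card (UNIV :: 'n set)"] hlt
    by auto
  define e where "e = enumerate Y"
  have e: "e k \<in> Y" "e k < e (Suc k)" for k
    using Y by (auto simp: e_def enumerate_in_set enumerate_step)
  define v where "v = c (e 0) (e 1)"
  have hv: "h (c x y) = t" if "x \<in> Y" "y \<in> Y" "x < y" for x y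
    using t[rule_format, OF that(1,2)] that(3) by simp
  have e01: "h v = t" unfolding v_def using hv[OF e(1) e(1) e(2), of 0] by simp
  have "inj h" using h by (simp add: bij_betw_def)
  have "c (e k) (e (Suc k)) = v" for k
    using hv[OF e(1) e(1) e(2), of k] e01 injD[OF \<open>inj h\<close>] by metis
  then have "Poly_Mapping.lookup (g (e (Suc k))) v < Poly_Mapping.lookup (g (e k)) v" for k
    using c[OF e(2)] by metis
  then show False
    using wf_no_infinite_down_chainE[OF wf_less_than, of "\<lambda>k. Poly_Mapping.lookup (g (e k)) v"]
    by (metis less_than_iff)
qed

lemma bm_select_terminates:
  assumes "finite \<Omega>" "finite A"
  shows "\<exists>A0. finite A0 \<and> (bm_select r)\<^sup>*\<^sup>* (\<Omega>, A) ({}, A0)"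
  using assms
proof (induction "card \<Omega>" arbitrary: \<Omega> A rule: less_induct)
  case less
  show ?case
  proof (cases "\<Omega> = {}")
    case True
    then show ?thesis using less.prems by blast
  next
    case False
    have fin: "finite (card ` \<Omega>)" using less.prems(1) by simp
    from False have "Max (card ` \<Omega>) \<in> card ` \<Omega>" using fin by (intro Max_in) auto
    then obtain \<sigma> where "\<sigma> \<in> \<Omega>" "card \<sigma> = Max (card ` \<Omega>)" by (metis imageE)
    then have \<sigma>: "\<sigma> \<in> \<Omega>" "\<forall>\<tau>\<in>\<Omega>. card \<tau> \<le> card \<sigma>" using fin by simp_all
    let ?\<Omega> = "\<Omega> - {\<sigma>, remove_sb r \<sigma>}"
    let ?A = "if sb r \<sigma> \<noteq> None then insert (\<sigma>, remove_sb r \<sigma>) A else A"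
    have step: "bm_select r (\<Omega>, A) (?\<Omega>, ?A)" using \<sigma> by (rule bm_select.intros)
    have "card ?\<Omega> < card \<Omega>" using \<sigma>(1) less.prems(1) by (intro psubset_card_mono) auto
    moreover have "finite ?\<Omega>" "finite ?A" using less.prems by simp_all
    ultimately have "\<exists>A0. finite A0 \<and> (bm_select r)\<^sup>*\<^sup>* (?\<Omega>, ?A) ({}, A0)"
      by (rule less.hyps)
    then obtain A0 where A0: "finite A0" "(bm_select r)\<^sup>*\<^sup>* (?\<Omega>, ?A) ({}, A0)"
      by (elim exE conjE)
    from converse_rtranclp_into_rtranclp[of "bm_select r", OF step A0(2)] A0(1)
    show ?thesis by (intro exI[of _ A0] conjI)
  qed
qed

lemma bm_prune_terminates:
  assumes "finite A"
  shows "\<exists>A1. (bm_prune r)\<^sup>*\<^sup>* A A1 \<and> (\<nexists>A'. bm_prune r A1 A')"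
  using assms
proof (induction "card A" arbitrary: A rule: less_induct)
  case less
  show ?case
  proof (cases "\<exists>A'. bm_prune r A A'")
    case True
    then obtain A' where A': "bm_prune r A A'" by blast
    then have "A' \<subset> A" by cases auto
    then have "card A' < card A" "finite A'"
      using less.prems by (auto intro: psubset_card_mono finite_subset)
    from less.hyps[OF this] obtain A1 where
      A1: "(bm_prune r)\<^sup>*\<^sup>* A' A1" "\<nexists>A'. bm_prune r A1 A'" by (elim exE conjE)
    from converse_rtranclp_into_rtranclp[of "bm_prune r", OF A' A1(1)] A1(2)
    show ?thesis by (intro exI[of _ A1] conjI)
  qed blast
qed

lemma barile_macchia_output_exists:
  fixes I :: "('n::finite, 'k::field) polynomial_ring set"
  shows "\<exists>A. barile_macchia (min_gens I) r A"
proof -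
  have "finite {\<sigma>. \<sigma> \<subseteq> min_gens I \<and> 3 \<le> card \<sigma>}"
    using finite_min_gens[of I] by (auto intro: finite_subset[of _ "Pow (min_gens I)"])
  then obtain A0 where A0: "finite A0"
      "(bm_select r)\<^sup>*\<^sup>* ({\<sigma>. \<sigma> \<subseteq> min_gens I \<and> 3 \<le> card \<sigma>}, {}) ({}, A0)"
    using bm_select_terminates by blast
  then show ?thesis using bm_prune_terminates unfolding barile_macchia_def by blast
qed

end

theory Submission
  imports Defs
begin

text \<open>Every edge that the algorithm ever produces removes the smallest bridge of its source, so it is
  an edge of the subset graph along which the lcm does not change. Two facts remain.

  \<^emph>\<open>Matching.\<close> Sets are selected in order of decreasing cardinality, and selecting a set discards the
  target of its edge. Hence no set is both a source and a target (\<open>bm_select_invariant\<close>). Two edges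
  with the same source coincide because the target is a function of the source, and two edges with
  the same target do not survive the pruning.

  \<^emph>\<open>Acyclicity.\<close> Suppose that the graph with reversed matching edges had a cycle. The lcm can only
  shrink along its edges, so it is constant on the cycle and every downward step of the cycle removes
  a bridge. As no set is both a source and a target, no two upward steps are consecutive, and since
  the cycle goes up as often as it goes down, upward and downward steps alternate. An upward step adds
  the smallest bridge of the set that it reaches, so the downward step after it, which is not the
  reversal of the same edge, removes a generator strictly greater than the one just added. Now let \<open>m\<close> be the smallest
  generator added on the cycle. It is removed at some later step, and the step just before that one
  added a generator smaller than \<open>m\<close>: a contradiction
  (\<open>acyclic_reverse_smallest_bridge_edges\<close>).\<close>

section \<open>Smallest bridges\<close>

lemma linear_order_on_finite_least:
  assumes "linear_order_on G r" "finite B" "B \<noteq> {}" "B \<subseteq> G"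
  obtains m where "m \<in> B" "\<forall>x\<in>B. (m, x) \<in> r"
proof -
  have refl: "(x, x) \<in> r" if "x \<in> G" for x
    using assms(1) that by (auto simp: order_on_defs refl_on_def)
  have "trans r" "total_on G r" using assms(1) by (auto simp: order_on_defs)
  have "\<exists>m\<in>B. \<forall>x\<in>B. (m, x) \<in> r"
    using assms(2-4)
  proof (induction rule: finite_ne_induct)
    case (singleton x)
    then show ?case using refl by auto
  next
    case (insert x F)
    then obtain m where m: "m \<in> F" "\<forall>y\<in>F. (m, y) \<in> r" by auto
    have xm: "x \<in> G" "m \<in> G" using m(1) insert.prems by auto
    then have "(x, m) \<in> r \<or> (m, x) \<in> r"
      using \<open>total_on G r\<close> refl[of x] by (cases "x = m") (auto simp: total_on_def)
    then show ?case
    proof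
      assume "(x, m) \<in> r"
      then have "\<forall>y\<in>insert x F. (x, y) \<in> r"
        using m(2) refl[OF xm(1)] transD[OF \<open>trans r\<close>, of x m] by simp
      then show ?thesis by simp
    next
      assume "(m, x) \<in> r"
      then have "\<forall>y\<in>insert x F. (m, y) \<in> r" using m(2) by simp
      then show ?thesis using m(1) by blast
    qed
  qed
  then show thesis using that by blast
qed

lemma sb_least_bridge:
  assumes "linear_order_on G r" "finite G" "\<sigma> \<subseteq> G" "sb r \<sigma> = Some m"
  shows "bridge m \<sigma>" "bridge m' \<sigma> \<Longrightarrow> (m, m') \<in> r"
proof -
  let ?least = "\<lambda>m. bridge m \<sigma> \<and> (\<forall>m'. bridge m' \<sigma> \<longrightarrow> (m, m') \<in> r)"
  have sub: "{m. bridge m \<sigma>} \<subseteq> G" using assms(3) by (auto simp: bridge_def)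
  have ex: "\<exists>m. bridge m \<sigma>" and m: "m = (THE m. ?least m)"
    using assms(4) by (auto simp: sb_def split: if_splits)
  obtain l where l: "?least l"
    using linear_order_on_finite_least[OF assms(1) finite_subset[OF sub assms(2)] _ sub] ex by auto
  have "antisym r" using assms(1) by (simp add: order_on_defs)
  then have "\<exists>!m. ?least m" using l by (metis antisymD)
  then have "?least m" unfolding m by (rule theI')
  then show "bridge m \<sigma>" "bridge m' \<sigma> \<Longrightarrow> (m, m') \<in> r" by auto
qed

lemma remove_sb_bridge:
  assumes "linear_order_on G r" "finite G" "\<sigma> \<subseteq> G" "sb r \<sigma> \<noteq> None"
  obtains m where "sb r \<sigma> = Some m" "remove_sb r \<sigma> = \<sigma> - {m}" "bridge m \<sigma>"
proof -
  obtain m where m: "sb r \<sigma> = Some m" using assms(4) by auto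
  moreover have "bridge m \<sigma>" by (rule sb_least_bridge(1)[OF assms(1-3) m])
  ultimately show thesis by (intro that) (simp_all add: remove_sb_def)
qed

lemma card_remove_sb:
  assumes "linear_order_on G r" "finite G" "\<sigma> \<subseteq> G" "sb r \<sigma> \<noteq> None"
  shows "card (remove_sb r \<sigma>) + 1 = card \<sigma>"
proof -
  obtain m where "remove_sb r \<sigma> = \<sigma> - {m}" "bridge m \<sigma>"
    using remove_sb_bridge[OF assms] by metis
  then show ?thesis
    using card_Suc_Diff1[of \<sigma> m] finite_subset[OF assms(3,2)] by (simp add: bridge_def)
qed

lemma lookup_lcm_mon_mono:
  assumes "\<tau> \<subseteq> \<sigma>" "finite \<sigma>"
  shows "Poly_Mapping.lookup (lcm_mon \<tau>) \<le> Poly_Mapping.lookup (lcm_mon \<sigma>)"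
proof (rule le_funI)
  fix i
  show "Poly_Mapping.lookup (lcm_mon \<tau>) i \<le> Poly_Mapping.lookup (lcm_mon \<sigma>) i"
    unfolding lookup_lcm_mon
    by (rule Max_mono) (use assms in auto)
qed

section \<open>Acyclicity\<close>

lemma monotone_const_on_cycle:
  fixes g :: "'v \<Rightarrow> 'b::order"
  assumes "\<And>v w. (v, w) \<in> R \<Longrightarrow> g w \<le> g v" "(u, v) \<in> R\<^sup>*" "(v, u) \<in> R\<^sup>*"
  shows "g u = g v"
proof -
  have "g y \<le> g x" if "(x, y) \<in> R\<^sup>*" for x y
    using that by induction (auto intro: order_trans assms(1))
  then show ?thesis using assms(2,3) by (metis antisym)
qed

lemma rtrancl_crossing_edge:
  assumes "(x, y) \<in> R\<^sup>*" "P x" "\<not> P y"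
  obtains v w where "(x, v) \<in> R\<^sup>*" "(v, w) \<in> R" "(w, y) \<in> R\<^sup>*" "P v" "\<not> P w"
proof -
  have "\<exists>v w. (x, v) \<in> R\<^sup>* \<and> (v, w) \<in> R \<and> (w, y) \<in> R\<^sup>* \<and> P v \<and> \<not> P w"
    using assms
  proof (induction rule: converse_rtrancl_induct)
    case base
    then show ?case by blast
  next
    case (step x z)
    then show ?case by (cases "P z") (meson converse_rtrancl_into_rtrancl rtrancl.rtrancl_refl)+
  qed
  then show thesis using that by blast
qed

text \<open>The alternation of upward and downward steps is expressed by a potential: the cardinality,
  raised by one at the targets of \<open>A\<close>, that is, where an upward step is possible. It does not grow
  along any edge: an upward step uses up the extra unit, because a source of \<open>A\<close> is not a target, and
  a downward step gains at most one such unit. On a cycle the potential is constant, which forces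
  each downward step to start outside the targets and to end in a target; so the step before it,
  and the step after it, go upward.\<close>

lemma acyclic_reverse_smallest_bridge_edges:
  fixes G :: "'n::finite monomial set"
  assumes lin: "linear_order_on G r" and fin: "finite G"
    and A: "\<And>\<sigma> \<tau>. (\<sigma>, \<tau>) \<in> A \<Longrightarrow> \<sigma> \<subseteq> G \<and> sb r \<sigma> \<noteq> None \<and> \<tau> = remove_sb r \<sigma>"
    and disj: "Domain A \<inter> Range A = {}"
  shows "acyclic (reverse_edges (edges G) A)"
proof (rule ccontr)
  define R where "R = reverse_edges (edges G) A"
  assume "\<not> acyclic (reverse_edges (edges G) A)"
  then obtain u where u: "(u, u) \<in> R\<^sup>+" by (auto simp: acyclic_def R_def)
  \<comment> \<open>The strongly connected component of \<open>u\<close> takes the place of the cycle.\<close>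
  define C where "C = {v. (u, v) \<in> R\<^sup>* \<and> (v, u) \<in> R\<^sup>*}"
  have R_cases: "(\<sigma>, \<tau>) \<in> edges G - A \<or> (\<tau>, \<sigma>) \<in> A" if "(\<sigma>, \<tau>) \<in> R" for \<sigma> \<tau>
    using that by (auto simp: R_def reverse_edges_def)
  have A_edge: "\<exists>m. sb r \<sigma> = Some m \<and> \<tau> = \<sigma> - {m} \<and> bridge m \<sigma> \<and> \<sigma> \<subseteq> G \<and> card \<tau> + 1 = card \<sigma>"
    if "(\<sigma>, \<tau>) \<in> A" for \<sigma> \<tau>
    using A[OF that] remove_sb_bridge[OF lin fin, of \<sigma>] card_remove_sb[OF lin fin, of \<sigma>] by metis
  have C_const: "g v = g w"
    if "\<And>v w. (v, w) \<in> R \<Longrightarrow> g w \<le> g v" "v \<in> C" "w \<in> C" for g :: "_ \<Rightarrow> 'b::order" and v w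
    using monotone_const_on_cycle[of R g, OF that(1)] that(2,3) unfolding C_def
    by (metis (mono_tags, lifting) mem_Collect_eq)

  have lcm_le: "Poly_Mapping.lookup (lcm_mon w) \<le> Poly_Mapping.lookup (lcm_mon v)" if "(v, w) \<in> R" for v w
    using R_cases[OF that]
  proof
    assume "(v, w) \<in> edges G - A"
    then have "w \<subseteq> v" "finite v" using finite_subset[OF _ fin] by (auto simp: edges_def)
    then show ?thesis by (rule lookup_lcm_mon_mono)
  next
    assume "(w, v) \<in> A"
    then show ?thesis using A_edge[of w v] by (auto simp: bridge_def)
  qed
  have lcm_C: "lcm_mon v = lcm_mon w" if "v \<in> C" "w \<in> C" for v w
    using C_const[of "\<lambda>v. Poly_Mapping.lookup (lcm_mon v)", OF lcm_le that]
    by (simp only: poly_mapping.lookup_inject)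

  define f where "f v = card v + (if v \<in> Range A then 1 else 0)" for v
  have f_le: "f w \<le> f v" if "(v, w) \<in> R" for v w
    using R_cases[OF that]
  proof
    assume "(v, w) \<in> edges G - A"
    then show ?thesis by (auto simp: f_def edges_def)
  next
    assume "(w, v) \<in> A"
    then have "v \<in> Range A" "w \<notin> Range A" using disj by auto
    then show ?thesis using A_edge[OF \<open>(w, v) \<in> A\<close>] by (auto simp: f_def)
  qed
  have f_C: "f v = f w" if "v \<in> C" "w \<in> C" for v w
    using C_const[of f, OF f_le that] .
  have down: "v \<notin> Range A \<and> w \<in> Range A" if "(v, w) \<in> edges G - A" "v \<in> C" "w \<in> C" for v w
    using f_C[OF that(2,3)] that(1) by (auto simp: f_def edges_def split: if_splits)

  have C_step: "v \<in> C \<and> w \<in> C" if "x \<in> C" "y \<in> C" "(x, v) \<in> R\<^sup>*" "(v, w) \<in> R" "(w, y) \<in> R\<^sup>*"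
    for x y v w
  proof -
    have "(u, x) \<in> R\<^sup>*" "(y, u) \<in> R\<^sup>*" using that(1,2) by (auto simp: C_def)
    then have "(u, v) \<in> R\<^sup>*" "(w, u) \<in> R\<^sup>*"
      using that(3,5) by (blast intro: rtrancl_trans)+
    then show ?thesis
      using that(4) by (simp add: C_def rtrancl_into_rtrancl converse_rtrancl_into_rtrancl)
  qed
  have "u \<in> C" by (simp add: C_def)

  define M where "M = {m. \<exists>\<sigma> \<tau>. (\<sigma>, \<tau>) \<in> A \<and> \<sigma> \<in> C \<and> \<tau> \<in> C \<and> sb r \<sigma> = Some m}"
  have "M \<subseteq> G" using A_edge by (fastforce simp: M_def bridge_def)
  moreover have "M \<noteq> {}"
  proof -
    from u obtain w where w: "(u, w) \<in> R" "(w, u) \<in> R\<^sup>*" by (meson tranclD)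
    then have "w \<in> C" by (auto simp: C_def)
    from R_cases[OF w(1)] show ?thesis
    proof
      assume "(w, u) \<in> A"
      then show ?thesis using \<open>w \<in> C\<close> \<open>u \<in> C\<close> A_edge unfolding M_def by blast
    next
      assume "(u, w) \<in> edges G - A"
      \<comment> \<open>A downward step must be compensated by a step that goes up again.\<close>
      then have "card w < card u" by (auto simp: edges_def)
      then obtain x y where xy: "(w, x) \<in> R\<^sup>*" "(x, y) \<in> R" "(y, u) \<in> R\<^sup>*"
          "card x < card u" "\<not> card y < card u"
        using rtrancl_crossing_edge[OF w(2), of "\<lambda>v. card v < card u"] by blast
      then have "(y, x) \<in> A" using R_cases[OF xy(2)] by (auto simp: edges_def)
      moreover have "x \<in> C" "y \<in> C" using C_step[OF \<open>w \<in> C\<close> \<open>u \<in> C\<close> xy(1-3)] by auto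
      ultimately show ?thesis using A_edge unfolding M_def by blast
    qed
  qed
  ultimately obtain m where m: "m \<in> M" "\<forall>x\<in>M. (m, x) \<in> r"
    using linear_order_on_finite_least[OF lin] finite_subset[OF _ fin] by metis
  then obtain \<sigma> \<tau> where \<sigma>: "(\<sigma>, \<tau>) \<in> A" "\<sigma> \<in> C" "\<tau> \<in> C" "sb r \<sigma> = Some m"
    by (auto simp: M_def)
  have m\<sigma>: "m \<in> \<sigma>" "m \<notin> \<tau>" using A_edge[OF \<sigma>(1)] \<sigma>(4) by (auto simp: bridge_def)
  have "(\<sigma>, \<tau>) \<in> R\<^sup>*" using \<sigma>(2,3) by (auto simp: C_def)
  then obtain v w where vw: "(\<sigma>, v) \<in> R\<^sup>*" "(v, w) \<in> R" "(w, \<tau>) \<in> R\<^sup>*" "m \<in> v" "m \<notin> w"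
    using rtrancl_crossing_edge[of \<sigma> \<tau> R "\<lambda>v. m \<in> v"] m\<sigma> by blast
  have C: "v \<in> C" "w \<in> C" using C_step[OF \<sigma>(2,3) vw(1-3)] by auto
  have vw_edge: "(v, w) \<in> edges G - A" using R_cases[OF vw(2)] A_edge[of w v] vw(4,5) by auto
  then have "w \<subseteq> v" "card w + 1 = card v" "v \<subseteq> G" by (auto simp: edges_def)
  then have w: "w = v - {m}"
    using vw(4,5) finite_subset[OF \<open>v \<subseteq> G\<close> fin] by (intro card_subset_eq) auto
  have "bridge m v" using lcm_C[OF C] vw(4) w by (simp add: bridge_def)

  \<comment> \<open>The cycle enters \<open>v\<close> by an upward step, since the downward step to \<open>w\<close> starts outside the targets.\<close>
  have "(v, v) \<in> R\<^sup>+"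
    using rtrancl_into_trancl2[OF vw(2) rtrancl_trans[of w u R v]] C by (simp add: C_def)
  then obtain x where x: "(v, x) \<in> R\<^sup>*" "(x, v) \<in> R" by (meson tranclD2)
  then have "x \<in> C" using C_step[OF C(1) C(1) x] by simp
  have "(v, x) \<in> A"
    using R_cases[OF x(2)] down[OF _ \<open>x \<in> C\<close> C(1)] down[OF vw_edge C] by blast
  then obtain c where c: "sb r v = Some c" "x = v - {c}" using A_edge by blast
  then have "c \<in> M" using \<open>(v, x) \<in> A\<close> C(1) \<open>x \<in> C\<close> unfolding M_def by blast
  then have "(m, c) \<in> r" using m(2) by blast
  moreover have "(c, m) \<in> r"
    by (rule sb_least_bridge(2)[OF lin fin \<open>v \<subseteq> G\<close> c(1) \<open>bridge m v\<close>])
  ultimately have "c = m" using lin by (auto simp: order_on_defs dest: antisymD)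
  then show False using c(2) w \<open>(v, x) \<in> A\<close> vw_edge by simp
qed

section \<open>The output of the algorithm\<close>

text \<open>The clauses relating \<open>A\<close> to \<open>\<Omega>\<close> are what keeps sources and targets disjoint: the target of a new
  edge has smaller cardinality than every earlier source, so it is not one of them, and the new
  source is not an earlier target because it still lies in \<open>\<Omega>\<close>.\<close>

definition bm_invariant where
  "bm_invariant G r \<Omega> A \<longleftrightarrow>
     (\<forall>\<sigma>\<in>\<Omega>. \<sigma> \<subseteq> G) \<and>
     (\<forall>(\<sigma>, \<tau>)\<in>A. \<sigma> \<subseteq> G \<and> sb r \<sigma> \<noteq> None \<and> \<tau> = remove_sb r \<sigma> \<and>
        \<tau> \<notin> \<Omega> \<and> (\<forall>\<rho>\<in>\<Omega>. card \<rho> \<le> card \<sigma>)) \<and>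
     Domain A \<inter> Range A = {}"

lemma bm_select_invariant_step:
  assumes "linear_order_on G r" "finite G" "bm_select r (\<Omega>, A) (\<Omega>', A')" "bm_invariant G r \<Omega> A"
  shows "bm_invariant G r \<Omega>' A'"
  using assms(3)
proof cases
  case (1 \<sigma>)
  show ?thesis
  proof (cases "sb r \<sigma> = None")
    case True
    then show ?thesis using 1 assms(4) by (auto simp: bm_invariant_def)
  next
    case False
    have "\<sigma> \<subseteq> G" using 1 assms(4) by (auto simp: bm_invariant_def)
    then have card: "card (remove_sb r \<sigma>) < card \<sigma>"
      using card_remove_sb[OF assms(1,2) _ False] by auto
    have "\<sigma> \<notin> Range A" using 1(3) assms(4) by (auto simp: bm_invariant_def)
    moreover have "remove_sb r \<sigma> \<notin> Domain A"
      using card 1(3) assms(4) by (fastforce simp: bm_invariant_def)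
    moreover have "\<sigma> \<noteq> remove_sb r \<sigma>" using card by auto
    moreover have "A' = insert (\<sigma>, remove_sb r \<sigma>) A" using 1 False by simp
    ultimately have "Domain A' \<inter> Range A' = {}"
      using assms(4) by (auto simp: bm_invariant_def)
    then show ?thesis
      using 1 False \<open>\<sigma> \<subseteq> G\<close> assms(4) unfolding bm_invariant_def by auto
  qed
qed

lemma bm_select_invariant:
  assumes "linear_order_on G r" "finite G" "(bm_select r)\<^sup>*\<^sup>* (\<Omega>, A) (\<Omega>', A')" "bm_invariant G r \<Omega> A"
  shows "bm_invariant G r \<Omega>' A'"
  using assms(3,4)
proof (induction rule: rtranclp_induct2)
  case (step \<Omega>' A' \<Omega>'' A'')
  then show ?case using bm_select_invariant_step[OF assms(1,2)] by blast
qed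

lemma bm_prune_subset: "(bm_prune r)\<^sup>*\<^sup>* A A' \<Longrightarrow> A' \<subseteq> A"
proof (induction rule: rtranclp_induct)
  case (step A' A'')
  from step.hyps(2) have "A'' \<subseteq> A'" by cases blast
  then show ?case using step.IH by blast
qed simp

lemma bm_prune_normal_inj:
  assumes "\<nexists>A'. bm_prune r A A'" "\<And>\<sigma> \<tau>. (\<sigma>, \<tau>) \<in> A \<Longrightarrow> sb r \<sigma> \<noteq> None \<and> \<tau> = remove_sb r \<sigma>"
    and "(\<sigma>, \<tau>) \<in> A" "(\<sigma>', \<tau>) \<in> A"
  shows "\<sigma> = \<sigma>'"
proof (rule ccontr)
  assume "\<sigma> \<noteq> \<sigma>'"
  moreover obtain m m' where "sb r \<sigma> = Some m" "sb r \<sigma>' = Some m'"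
    using assms(2)[OF assms(3)] assms(2)[OF assms(4)] by auto
  moreover have "remove_sb r \<sigma> = \<tau>" "remove_sb r \<sigma>' = \<tau>" using assms(2-4) by metis+
  ultimately show False
    using bm_prune.intros[of \<sigma> r A \<sigma>' m m'] assms(1,3,4) by auto
qed

theorem theorem2p11:
  fixes I :: "('n::finite, 'k::field) polynomial_ring set"
    and r :: "'n monomial rel"
    and A :: "('n monomial set \<times> 'n monomial set) set"
  assumes "monomial_ideal I"
    and "linear_order_on (min_gens I) r"
    and "barile_macchia (min_gens I) r A"
  shows "lcm_homogeneous_acyclic_matching (min_gens I) A"
proof -
  let ?G = "min_gens I"
  note lin = assms(2) and fin = finite_min_gens[of I]
  obtain A0 where A0: "(bm_select r)\<^sup>*\<^sup>* ({\<sigma>. \<sigma> \<subseteq> ?G \<and> 3 \<le> card \<sigma>}, {}) ({}, A0)"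
      "(bm_prune r)\<^sup>*\<^sup>* A0 A" and normal: "\<nexists>A'. bm_prune r A A'"
    using assms(3) by (auto simp: barile_macchia_def)
  have "bm_invariant ?G r {} A0"
    by (rule bm_select_invariant[OF lin fin A0(1)]) (simp add: bm_invariant_def)
  moreover have "A \<subseteq> A0" by (rule bm_prune_subset[OF A0(2)])
  ultimately have A: "\<sigma> \<subseteq> ?G \<and> sb r \<sigma> \<noteq> None \<and> \<tau> = remove_sb r \<sigma>" if "(\<sigma>, \<tau>) \<in> A" for \<sigma> \<tau>
    using that unfolding bm_invariant_def by blast
  have disj: "Domain A \<inter> Range A = {}"
    using \<open>bm_invariant ?G r {} A0\<close> \<open>A \<subseteq> A0\<close> unfolding bm_invariant_def by blast
  have inj: "\<sigma> = \<sigma>'" if "(\<sigma>, \<tau>) \<in> A" "(\<sigma>', \<tau>) \<in> A" for \<sigma> \<sigma>' \<tau>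
    using bm_prune_normal_inj[OF normal] A that by blast
  have edge: "(\<sigma>, \<tau>) \<in> edges ?G \<and> lcm_mon \<sigma> = lcm_mon \<tau>" if e: "(\<sigma>, \<tau>) \<in> A" for \<sigma> \<tau>
  proof -
    obtain m where "\<tau> = \<sigma> - {m}" "bridge m \<sigma>"
      using remove_sb_bridge[OF lin fin, of \<sigma>] A[OF e] by metis
    then show ?thesis
      using A[OF e] card_remove_sb[OF lin fin, of \<sigma>] by (auto simp: edges_def bridge_def)
  qed
  have matching: "e = e'"
    if "e \<in> A" "e' \<in> A" "\<sigma> = fst e \<or> \<sigma> = snd e" "\<sigma> = fst e' \<or> \<sigma> = snd e'" for e e' \<sigma>
  proof (cases e, cases e')
    fix a b a' b' assume e: "e = (a, b)" "e' = (a', b')"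
    then have "a \<noteq> b'" "b \<noteq> a'" using that(1,2) disj by auto
    then have "a = a' \<or> b = b'" using that(3,4) e by auto
    then show "e = e'"
      using A[of a b] A[of a' b'] inj[of a b a'] that(1,2) e by metis
  qed
  show ?thesis
    unfolding lcm_homogeneous_acyclic_matching_def
  proof (intro conjI)
    show "A \<subseteq> edges ?G" "\<forall>(\<sigma>, \<sigma>')\<in>A. lcm_mon \<sigma> = lcm_mon \<sigma>'" using edge by auto
    show "\<forall>\<sigma>. \<sigma> \<subseteq> ?G \<longrightarrow> (\<forall>e\<in>A. \<forall>e'\<in>A.
        (\<sigma> = fst e \<or> \<sigma> = snd e) \<longrightarrow> (\<sigma> = fst e' \<or> \<sigma> = snd e') \<longrightarrow> e = e')"
      by (intro allI ballI impI) (rule matching)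
    show "acyclic (reverse_edges (edges ?G) A)"
      by (rule acyclic_reverse_smallest_bridge_edges[OF lin fin A disj])
  qed
qed

end
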